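(* Let $G$ and $H$ be finite groups and let $A=G\ltimes H$ be a semi-direct product of these groups (with $H$ the normal factor, so that $H$ is normal in $A$ and $A/H\cong G$). Then $$\operatorname{cp}(A)\ \le\ \operatorname{cp}(G)\operatorname{cp}(H).$$
   Context: For a finite group $G$, the commuting probability of $G$ is $\operatorname{cp}(G)=\dfrac{|L(G)|}{|G|^2}$, where $L(G)=\{(x,y)\in G\times G: xy=yx\}$. The semi-direct product is taken with respect to an arbitrary homomorphism $G\to\operatorname{Aut}(H)$. *)

theory Defs
  imports Complex_Main "HOL-Algebra.Coset" "HOL-Algebra.Bij"
begin

definition commuting_pairs :: "('a, 'b) monoid_scheme \<Rightarrow> ('a \<times> 'a) set" where
  "commuting_pairs G =
    {(x, y). x \<in> carrier G \<and> y \<in> carrier G \<and> x \<otimes>\<^bsub>G\<^esub> y = y \<otimes>\<^bsub>G\<^esub> x}"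

definition cp :: "('a, 'b) monoid_scheme \<Rightarrow> real" where
  "cp G = real (card (commuting_pairs G)) / real (order G) ^ 2"

(* External semidirect product with normal factor H.  The pair (g, h) stands for the
   element h g, where g acts on H by conjugation g h g^-1 = phi g h, so that
   (h1 g1) (h2 g2) = (h1 (phi g1 h2)) (g1 g2). *)
definition semidirect ::
  "('a, 'c) monoid_scheme \<Rightarrow> ('b, 'd) monoid_scheme \<Rightarrow> ('a \<Rightarrow> 'b \<Rightarrow> 'b) \<Rightarrow> ('a \<times> 'b) monoid"
where
  "semidirect G H \<phi> =
    \<lparr>carrier = carrier G \<times> carrier H,
     mult = (\<lambda>(g1, h1) (g2, h2). (g1 \<otimes>\<^bsub>G\<^esub> g2, h1 \<otimes>\<^bsub>H\<^esub> \<phi> g1 h2)),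
     one = (\<one>\<^bsub>G\<^esub>, \<one>\<^bsub>H\<^esub>)\<rparr>"

lemma semidirect_simps:
  "carrier (semidirect G H \<phi>) = carrier G \<times> carrier H"
  "(g1, h1) \<otimes>\<^bsub>semidirect G H \<phi>\<^esub> (g2, h2) = (g1 \<otimes>\<^bsub>G\<^esub> g2, h1 \<otimes>\<^bsub>H\<^esub> \<phi> g1 h2)"
  "\<one>\<^bsub>semidirect G H \<phi>\<^esub> = (\<one>\<^bsub>G\<^esub>, \<one>\<^bsub>H\<^esub>)"
  by (simp_all add: semidirect_def)

context
  fixes G :: "('a, 'c) monoid_scheme" and H :: "('b, 'd) monoid_scheme" and \<phi>
  assumes G: "group G" and H: "group H" and hom: "\<phi> \<in> hom G (AutoGroup H)"
begin

interpretation G: group G by (rule G)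
interpretation H: group H by (rule H)

lemma action_auto: "g \<in> carrier G \<Longrightarrow> \<phi> g \<in> auto H"
  using hom by (auto simp: hom_def AutoGroup_def)

lemma action_closed: "g \<in> carrier G \<Longrightarrow> h \<in> carrier H \<Longrightarrow> \<phi> g h \<in> carrier H"
  using action_auto by (auto simp: auto_def hom_def)

lemma action_hom:
  "g \<in> carrier G \<Longrightarrow> h \<in> carrier H \<Longrightarrow> k \<in> carrier H \<Longrightarrow> \<phi> g (h \<otimes>\<^bsub>H\<^esub> k) = \<phi> g h \<otimes>\<^bsub>H\<^esub> \<phi> g k"
  using action_auto by (auto simp: auto_def hom_def)

lemma action_mult:
  assumes "g \<in> carrier G" "k \<in> carrier G" "h \<in> carrier H"
  shows "\<phi> (g \<otimes>\<^bsub>G\<^esub> k) h = \<phi> g (\<phi> k h)"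
proof -
  have "\<phi> (g \<otimes>\<^bsub>G\<^esub> k) = \<phi> g \<otimes>\<^bsub>AutoGroup H\<^esub> \<phi> k"
    using hom assms by (auto simp: hom_def)
  then show ?thesis
    using action_auto[of g] action_auto[of k] assms
    by (simp add: AutoGroup_def BijGroup_def auto_def compose_def)
qed

lemma action_one: "h \<in> carrier H \<Longrightarrow> \<phi> \<one>\<^bsub>G\<^esub> h = h"
proof -
  assume h: "h \<in> carrier H"
  have "inj_on (\<phi> \<one>\<^bsub>G\<^esub>) (carrier H)"
    using action_auto[OF G.one_closed] by (auto simp: auto_def Bij_def bij_betw_def)
  moreover have "\<phi> \<one>\<^bsub>G\<^esub> (\<phi> \<one>\<^bsub>G\<^esub> h) = \<phi> \<one>\<^bsub>G\<^esub> h"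
    using action_mult[OF G.one_closed G.one_closed h] by simp
  ultimately show ?thesis
    using h action_closed[OF G.one_closed h] by (meson inj_onD)
qed

lemma group_semidirect: "group (semidirect G H \<phi>)"
proof (rule groupI, goal_cases)
  case (5 x)
  then obtain g h where x: "x = (g, h)" "g \<in> carrier G" "h \<in> carrier H"
    by (auto simp: semidirect_simps)
  let ?i = "inv\<^bsub>G\<^esub> g"
  have "(?i, inv\<^bsub>H\<^esub> (\<phi> ?i h)) \<otimes>\<^bsub>semidirect G H \<phi>\<^esub> x = \<one>\<^bsub>semidirect G H \<phi>\<^esub>"
    using x by (simp add: semidirect_simps action_closed)
  moreover have "(?i, inv\<^bsub>H\<^esub> (\<phi> ?i h)) \<in> carrier (semidirect G H \<phi>)"
    using x by (simp add: semidirect_simps action_closed)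
  ultimately show ?case by blast
qed (auto simp: semidirect_simps action_closed action_hom action_mult action_one
       G.m_assoc H.m_assoc)

lemma fst_hom_semidirect: "group_hom (semidirect G H \<phi>) G fst"
  by (rule group_hom.intro[OF group_semidirect G])
     (auto simp: group_hom_axioms_def hom_def semidirect_simps)

lemma snd_iso_semidirect_factor:
  "snd \<in> iso (semidirect G H \<phi> \<lparr>carrier := {\<one>\<^bsub>G\<^esub>} \<times> carrier H\<rparr>) H"
  by (auto simp: iso_def hom_def semidirect_simps action_one bij_betw_def inj_on_def image_iff)

lemma normal_semidirect: "{\<one>\<^bsub>G\<^esub>} \<times> carrier H \<lhd> semidirect G H \<phi>"
proof -
  have "kernel (semidirect G H \<phi>) G fst = {\<one>\<^bsub>G\<^esub>} \<times> carrier H"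
    by (auto simp: kernel_def semidirect_simps)
  then show ?thesis
    using group_hom.normal_kernel[OF fst_hom_semidirect] by simp
qed

lemma semidirect_quotient: "semidirect G H \<phi> Mod ({\<one>\<^bsub>G\<^esub>} \<times> carrier H) \<cong> G"
proof -
  have "kernel (semidirect G H \<phi>) G fst = {\<one>\<^bsub>G\<^esub>} \<times> carrier H"
    by (auto simp: kernel_def semidirect_simps)
  moreover have "fst ` carrier (semidirect G H \<phi>) = carrier G"
    using H.one_closed by (force simp: semidirect_simps)
  ultimately show ?thesis
    using group_hom.FactGroup_iso[OF fst_hom_semidirect] by simp
qed

end

end

theory Submission
  imports Defs
begin

text \<open>
  The elements \<open>(g\<^sub>1, h\<^sub>1)\<close> and \<open>(g\<^sub>2, h\<^sub>2)\<close> of the semidirect product commute exactly when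
  \<open>g\<^sub>1\<close> and \<open>g\<^sub>2\<close> commute in \<open>G\<close> and \<open>h\<^sub>1 (\<phi> g\<^sub>1 h\<^sub>2) = h\<^sub>2 (\<phi> g\<^sub>2 h\<^sub>1)\<close> holds in \<open>H\<close>.
  Since the order of the product is \<open>|G| |H|\<close>, it suffices that for each pair \<open>(g\<^sub>1, g\<^sub>2)\<close>
  the second equation has at most as many solutions \<open>(h\<^sub>1, h\<^sub>2)\<close> as the untwisted equation
  \<open>h\<^sub>1 h\<^sub>2 = h\<^sub>2 h\<^sub>1\<close>.  This is \<open>card_twisted_commuting_pairs_le\<close>, with the automorphisms
  \<open>\<alpha> = \<phi> g\<^sub>1\<close> and \<open>\<beta> = \<phi> g\<^sub>2\<close>.

  Its proof removes the two twists one after the other.  For fixed \<open>h\<close> the solutions \<open>k\<close> of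
  \<open>h (\<alpha> k) = k (\<beta> h)\<close>, if there are any, form a coset of the group of all \<open>t\<close> with
  \<open>t c = c (\<alpha> t)\<close>, where \<open>c = \<beta> h\<close>.  As \<open>\<beta>\<close> is a bijection, the number of solutions is at
  most the number of pairs \<open>(c, t)\<close> with \<open>t c = c (\<alpha> t)\<close>.  Counting these with \<open>t\<close> fixed
  instead, the elements \<open>c\<close> that conjugate \<open>t\<close> to \<open>\<alpha> t\<close> form a coset of the centralizer of
  \<open>t\<close> or the empty set, and the orders of the centralizers add up to the number of commuting
  pairs.  This is Gallagher's counting argument for a group with a given normal subgroup,
  in the coordinates of a semidirect product.
\<close>

context group
begin

lemma commuting_pairs_eq_Sigma:
  "commuting_pairs G = (SIGMA x:carrier G. {y \<in> carrier G. x \<otimes> y = y \<otimes> x})"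
  by (auto simp: commuting_pairs_def)

text \<open>Two elements that conjugate \<open>t\<close> to the same \<open>s\<close> differ by an element of the centralizer
  of \<open>t\<close>, so dividing by a fixed conjugator embeds the left-hand set into that centralizer.\<close>

lemma card_conjugators_le_card_centralizer:
  assumes fin: "finite (carrier G)" and t: "t \<in> carrier G" and s: "s \<in> carrier G"
  shows "card {c \<in> carrier G. t \<otimes> c = c \<otimes> s} \<le> card {c \<in> carrier G. t \<otimes> c = c \<otimes> t}"
    (is "card ?A \<le> card ?B")
proof (cases "?A = {}")
  case True
  then show ?thesis by (metis card.empty le0)
next
  case False
  then obtain d where d: "d \<in> carrier G" "t \<otimes> d = d \<otimes> s" by blast
  have s_eq: "s = inv d \<otimes> (t \<otimes> d)"
    using d t s by (simp add: inv_solve_left)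
  have "(\<lambda>c. c \<otimes> inv d) ` ?A \<subseteq> ?B"
  proof clarify
    fix c assume c: "c \<in> carrier G" "t \<otimes> c = c \<otimes> s"
    have "t \<otimes> (c \<otimes> inv d) = (c \<otimes> s) \<otimes> inv d"
      using c d t by (metis inv_closed m_assoc)
    also have "\<dots> = c \<otimes> inv d \<otimes> t"
      using c(1) d(1) t by (simp add: s_eq m_assoc)
    finally show "c \<otimes> inv d \<in> carrier G \<and> t \<otimes> (c \<otimes> inv d) = c \<otimes> inv d \<otimes> t"
      using c d by simp
  qed
  moreover have "inj_on (\<lambda>c. c \<otimes> inv d) ?A"
    using d by (auto intro!: inj_onI)
  ultimately show ?thesis
    using fin by (intro card_inj_on_le[where f = "\<lambda>c. c \<otimes> inv d"]) auto
qed

text \<open>The equation \<open>h \<otimes> \<alpha> k = k \<otimes> c\<close> in the unknown \<open>k\<close> is the inhomogeneous version of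
  \<open>t \<otimes> c = c \<otimes> \<alpha> t\<close>: if \<open>k\<close> and \<open>m\<close> are solutions, then \<open>t = inv m \<otimes> k\<close> solves the latter.\<close>

lemma card_twisted_commuting_fibre_le:
  assumes fin: "finite (carrier G)" and \<alpha>: "\<alpha> \<in> hom G G"
    and h: "h \<in> carrier G" and c: "c \<in> carrier G"
  shows "card {k \<in> carrier G. h \<otimes> \<alpha> k = k \<otimes> c} \<le> card {t \<in> carrier G. t \<otimes> c = c \<otimes> \<alpha> t}"
    (is "card ?A \<le> card ?B")
proof (cases "?A = {}")
  case True
  then show ?thesis by (metis card.empty le0)
next
  case False
  then obtain m where m: "m \<in> carrier G" "h \<otimes> \<alpha> m = m \<otimes> c" by blast
  have closed: "\<alpha> x \<in> carrier G" if "x \<in> carrier G" for x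
    using \<alpha> that by (auto simp: hom_def)
  have "(\<lambda>k. inv m \<otimes> k) ` ?A \<subseteq> ?B"
  proof clarify
    fix k assume k: "k \<in> carrier G" "h \<otimes> \<alpha> k = k \<otimes> c"
    define t where "t = inv m \<otimes> k"
    have t: "t \<in> carrier G" and k_eq: "k = m \<otimes> t"
      using k(1) m(1) by (simp_all add: t_def flip: m_assoc)
    have "\<alpha> k = \<alpha> m \<otimes> \<alpha> t"
      using \<alpha> m t by (simp add: k_eq hom_mult)
    then have "m \<otimes> (t \<otimes> c) = m \<otimes> (c \<otimes> \<alpha> t)"
      using k m t c h closed by (metis k_eq m_assoc)
    then show "inv m \<otimes> k \<in> carrier G \<and> inv m \<otimes> k \<otimes> c = c \<otimes> \<alpha> (inv m \<otimes> k)"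
      using m t c closed by (simp flip: t_def)
  qed
  moreover have "inj_on (\<lambda>k. inv m \<otimes> k) ?A"
    using m by (auto intro!: inj_onI)
  ultimately show ?thesis
    using fin by (intro card_inj_on_le[where f = "\<lambda>k. inv m \<otimes> k"]) auto
qed

text \<open>The twist \<open>\<beta>\<close> disappears by comparing fibres over \<open>h\<close> and substituting \<open>c = \<beta> h\<close>;
  the twist \<open>\<alpha>\<close> disappears by comparing fibres over \<open>t\<close> after exchanging the summations.\<close>

lemma card_twisted_commuting_pairs_le:
  assumes fin: "finite (carrier G)" and \<alpha>: "\<alpha> \<in> hom G G"
    and \<beta>: "bij_betw \<beta> (carrier G) (carrier G)"
  shows "card (SIGMA h:carrier G. {k \<in> carrier G. h \<otimes> \<alpha> k = k \<otimes> \<beta> h})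
    \<le> card (commuting_pairs G)"
proof -
  have "card (SIGMA h:carrier G. {k \<in> carrier G. h \<otimes> \<alpha> k = k \<otimes> \<beta> h})
      = (\<Sum>h\<in>carrier G. card {k \<in> carrier G. h \<otimes> \<alpha> k = k \<otimes> \<beta> h})"
    using fin by simp
  also have "\<dots> \<le> (\<Sum>h\<in>carrier G. card {t \<in> carrier G. t \<otimes> \<beta> h = \<beta> h \<otimes> \<alpha> t})"
    using fin \<alpha> bij_betwE[OF \<beta>] by (intro sum_mono card_twisted_commuting_fibre_le) auto
  also have "\<dots> = (\<Sum>c\<in>carrier G. card {t \<in> carrier G. t \<otimes> c = c \<otimes> \<alpha> t})"
    by (rule sum.reindex_bij_betw[OF \<beta>])
  also have "\<dots> = (\<Sum>t\<in>carrier G. card {c \<in> carrier G. t \<otimes> c = c \<otimes> \<alpha> t})"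
    unfolding card_eq_sum using fin fin by (rule sum.swap_restrict)
  also have "\<dots> \<le> (\<Sum>t\<in>carrier G. card {c \<in> carrier G. t \<otimes> c = c \<otimes> t})"
    using fin \<alpha> by (intro sum_mono card_conjugators_le_card_centralizer) (auto simp: hom_def)
  also have "\<dots> = card (commuting_pairs G)"
    using fin by (simp add: commuting_pairs_eq_Sigma)
  finally show ?thesis .
qed

end

lemma card_commuting_pairs_semidirect_le:
  assumes G: "group G" and finG: "finite (carrier G)"
    and H: "group H" and finH: "finite (carrier H)"
    and hom: "\<phi> \<in> hom G (AutoGroup H)"
  shows "card (commuting_pairs (semidirect G H \<phi>))
    \<le> card (commuting_pairs G) * card (commuting_pairs H)"
proof -
  define T where "T = (\<lambda>(g1, g2). SIGMA h:carrier H.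
    {k \<in> carrier H. h \<otimes>\<^bsub>H\<^esub> \<phi> g1 k = k \<otimes>\<^bsub>H\<^esub> \<phi> g2 h})"
  have finL: "finite (commuting_pairs G)"
    by (rule finite_subset[of _ "carrier G \<times> carrier G"])
      (use finG in \<open>auto simp: commuting_pairs_def\<close>)
  have finT: "finite (T p)" for p
    using finH by (auto simp: T_def split: prod.split)
  have card_T: "card (T p) \<le> card (commuting_pairs H)" if "p \<in> commuting_pairs G" for p
  proof -
    obtain g1 g2 where p: "p = (g1, g2)" "g1 \<in> carrier G" "g2 \<in> carrier G"
      using \<open>p \<in> commuting_pairs G\<close> by (auto simp: commuting_pairs_def)
    have "\<phi> g1 \<in> hom H H" "bij_betw (\<phi> g2) (carrier H) (carrier H)"
      using p action_auto[OF G H hom] by (auto simp: auto_def Bij_def)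
    then show ?thesis
      unfolding p T_def using group.card_twisted_commuting_pairs_le[OF H finH] by simp
  qed
  let ?f = "\<lambda>((g1, h1), (g2, h2)). ((g1, g2), (h1, h2))"
  have "card (commuting_pairs (semidirect G H \<phi>)) \<le> card (Sigma (commuting_pairs G) T)"
  proof (rule card_inj_on_le[where f = ?f])
    show "inj_on ?f (commuting_pairs (semidirect G H \<phi>))"
      by (auto intro!: inj_onI)
    show "?f ` commuting_pairs (semidirect G H \<phi>) \<subseteq> Sigma (commuting_pairs G) T"
      by (auto simp: commuting_pairs_def semidirect_simps T_def)
    show "finite (Sigma (commuting_pairs G) T)"
      using finL finT by blast
  qed
  also have "\<dots> = (\<Sum>p\<in>commuting_pairs G. card (T p))"
    using finL finT by simp
  also have "\<dots> \<le> card (commuting_pairs G) * card (commuting_pairs H)"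
    using sum_bounded_above[of "commuting_pairs G" "\<lambda>p. card (T p)"] card_T by simp
  finally show ?thesis .
qed

theorem corollary18p1:
  fixes G :: "('a, 'c) monoid_scheme" and H :: "('b, 'd) monoid_scheme"
    and \<phi> :: "'a \<Rightarrow> 'b \<Rightarrow> 'b"
  assumes "group G" and "finite (carrier G)"
    and "group H" and "finite (carrier H)"
    and "\<phi> \<in> hom G (AutoGroup H)"
  shows "cp (semidirect G H \<phi>) \<le> cp G * cp H"
proof -
  have "real (card (commuting_pairs (semidirect G H \<phi>)))
      \<le> real (card (commuting_pairs G)) * real (card (commuting_pairs H))"
    using card_commuting_pairs_semidirect_le[OF assms] by (simp flip: of_nat_mult)
  moreover have "order (semidirect G H \<phi>) = order G * order H"
    by (simp add: order_def semidirect_simps card_cartesian_product)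
  ultimately show ?thesis
    by (simp add: cp_def power_mult_distrib divide_right_mono)
qed

end
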